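(* Let $(D,\star)$ be a finite abelian group with identity $e$, and let $\delta\colon D\to\mathbb{R}_{\ge0}$ be a function satisfying: (i) $\delta(e)=0$ and $\delta(d)>0$ for all $d\ne e$; (ii) $\delta(d_1\star d_2)\le\delta(d_1)+\delta(d_2)$ for all $d_1,d_2\in D$; (iii) $\delta(d^{-1})=\delta(d)$ for all $d\in D$. Then the function \[d^{\star}(x,y)=\sum_{i=1}^n\delta\bigl(x_i\star y_i^{-1}\bigr)\] is a metric on $D^n$. Moreover, the group operation is an isometry: $d^{\star}(a\star c,\,b\star c)=d^{\star}(a,b)$ for all $a,b,c\in D^n$.
   Context: The operation $\star$ on $D^n$ is componentwise. *)

theory Defs
  imports "HOL-Algebra.Product_Groups" "HOL-Analysis.Abstract_Metric_Spaces"
begin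

text \<open>The direct power of a group: tuples indexed by \<open>{1..n}\<close>, as extensional functions, under the
  componentwise operation.\<close>

definition group_power :: "('a, 'b) monoid_scheme \<Rightarrow> nat \<Rightarrow> (nat \<Rightarrow> 'a) monoid"
  where "group_power G n = product_group {1..n} (\<lambda>_. G)"

definition dstar ::
    "('a, 'b) monoid_scheme \<Rightarrow> nat \<Rightarrow> ('a \<Rightarrow> real) \<Rightarrow> (nat \<Rightarrow> 'a) \<Rightarrow> (nat \<Rightarrow> 'a) \<Rightarrow> real"
  where "dstar G n \<delta> x y = (\<Sum>i = 1..n. \<delta> (x i \<otimes>\<^bsub>G\<^esub> inv\<^bsub>G\<^esub> (y i)))"

text \<open>The locale \<^locale>\<open>Metric_space\<close> asks for nonnegativity and symmetry on the whole ambient type,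
  whereas a metric on \<open>M\<close> is a function on \<open>M \<times> M\<close> only. So the irrelevant values outside
  \<open>M \<times> M\<close> are replaced by 0; on \<open>M\<close> the conditions are exactly the metric axioms for \<open>d\<close>.\<close>

definition metric_on :: "'a set \<Rightarrow> ('a \<Rightarrow> 'a \<Rightarrow> real) \<Rightarrow> bool"
  where "metric_on M d \<longleftrightarrow> Metric_space M (\<lambda>x y. if x \<in> M \<and> y \<in> M then d x y else 0)"

end

theory Submission
  imports Defs
begin

text \<open>
  The function \<open>\<delta>\<close> is a norm on the group, and \<open>\<delta> (x \<otimes> inv y)\<close> is the right-invariant distance that it
  induces. The three metric axioms are the three norm axioms read through the quotient \<open>x \<otimes> inv y\<close>:
  this quotient is trivial only for \<open>x = y\<close>, it is inverted when \<open>x\<close> and \<open>y\<close> are exchanged, and the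
  quotient of \<open>x\<close> and \<open>z\<close> is the product of those of \<open>x\<close>, \<open>y\<close> and of \<open>y\<close>, \<open>z\<close>. A common right factor
  cancels in the quotient, which gives the isometry. The distance on the direct power is the sum of
  the distances of the coordinates, so everything passes to it term by term; for
  separation of points, a vanishing sum of nonnegative terms forces every term to vanish.
\<close>

text \<open>
  The metric axioms need checking on \<open>M\<close> only: the default value 0 outside \<open>M\<close> is nonnegative and
  symmetric, as the metric locale demands of the whole type.
\<close>

lemma metric_onI:
  assumes "\<And>x y. x \<in> M \<Longrightarrow> y \<in> M \<Longrightarrow> 0 \<le> d x y"
    and "\<And>x y. x \<in> M \<Longrightarrow> y \<in> M \<Longrightarrow> d x y = d y x"
    and "\<And>x y. x \<in> M \<Longrightarrow> y \<in> M \<Longrightarrow> d x y = 0 \<longleftrightarrow> x = y"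
    and "\<And>x y z. x \<in> M \<Longrightarrow> y \<in> M \<Longrightarrow> z \<in> M \<Longrightarrow> d x z \<le> d x y + d y z"
  shows "metric_on M d"
  unfolding metric_on_def by unfold_locales (use assms in auto)

lemma mem_carrier_group_power:
  "x \<in> carrier (group_power G n) \<longleftrightarrow> x \<in> (\<Pi>\<^sub>E i\<in>{1..n}. carrier G)"
  by (simp add: group_power_def)

lemma mult_group_power:
  assumes "i \<in> {1..n}"
  shows "(x \<otimes>\<^bsub>group_power G n\<^esub> y) i = x i \<otimes>\<^bsub>G\<^esub> y i"
  using assms by (simp add: group_power_def)

locale group_norm = group G for G :: "('a, 'b) monoid_scheme" (structure) +
  fixes \<delta> :: "'a \<Rightarrow> real"
  assumes norm_nonneg: "x \<in> carrier G \<Longrightarrow> 0 \<le> \<delta> x"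
    and norm_eq_0_iff: "x \<in> carrier G \<Longrightarrow> \<delta> x = 0 \<longleftrightarrow> x = \<one>"
    and norm_mult_le: "x \<in> carrier G \<Longrightarrow> y \<in> carrier G \<Longrightarrow> \<delta> (x \<otimes> y) \<le> \<delta> x + \<delta> y"
    and norm_inv: "x \<in> carrier G \<Longrightarrow> \<delta> (inv x) = \<delta> x"
begin

lemma norm_quotient_eq_0_iff:
  assumes "x \<in> carrier G" "y \<in> carrier G"
  shows "\<delta> (x \<otimes> inv y) = 0 \<longleftrightarrow> x = y"
  using assms by (metis norm_eq_0_iff inv_closed m_closed r_inv inv_equality inv_inv)

lemma norm_quotient_commute:
  assumes "x \<in> carrier G" "y \<in> carrier G"
  shows "\<delta> (x \<otimes> inv y) = \<delta> (y \<otimes> inv x)"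
proof -
  have "inv (x \<otimes> inv y) = y \<otimes> inv x"
    using assms by (simp add: inv_mult_group)
  then show ?thesis
    using assms norm_inv[of "x \<otimes> inv y"] by simp
qed

lemma norm_quotient_triangle:
  assumes "x \<in> carrier G" "y \<in> carrier G" "z \<in> carrier G"
  shows "\<delta> (x \<otimes> inv z) \<le> \<delta> (x \<otimes> inv y) + \<delta> (y \<otimes> inv z)"
proof -
  have "x \<otimes> inv z = (x \<otimes> inv y) \<otimes> (y \<otimes> inv z)"
    using assms by (simp add: m_assoc inv_solve_left)
  then show ?thesis
    using assms norm_mult_le[of "x \<otimes> inv y" "y \<otimes> inv z"] by simp
qed

lemma quotient_mult_right:
  assumes "x \<in> carrier G" "y \<in> carrier G" "c \<in> carrier G"
  shows "(x \<otimes> c) \<otimes> inv (y \<otimes> c) = x \<otimes> inv y"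
proof -
  have "c \<otimes> (inv c \<otimes> inv y) = inv y"
    using assms by (simp flip: m_assoc)
  then show ?thesis
    using assms by (simp add: inv_mult_group m_assoc)
qed

lemma metric_on_dstar: "metric_on (carrier (group_power G n)) (dstar G n \<delta>)"
proof (rule metric_onI)
  fix x y assume "x \<in> carrier (group_power G n)" "y \<in> carrier (group_power G n)"
  then have x: "x \<in> (\<Pi>\<^sub>E i\<in>{1..n}. carrier G)" and y: "y \<in> (\<Pi>\<^sub>E i\<in>{1..n}. carrier G)"
    by (simp_all only: mem_carrier_group_power)
  have mem: "x i \<in> carrier G" "y i \<in> carrier G" if "i \<in> {1..n}" for i
    using x y that by auto
  have nonneg: "0 \<le> \<delta> (x i \<otimes> inv (y i))" if "i \<in> {1..n}" for i
    using mem[OF that] by (simp add: norm_nonneg)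
  show "0 \<le> dstar G n \<delta> x y"
    unfolding dstar_def by (intro sum_nonneg nonneg)
  show "dstar G n \<delta> x y = dstar G n \<delta> y x"
    unfolding dstar_def by (intro sum.cong refl norm_quotient_commute mem)
  have "dstar G n \<delta> x y = 0 \<longleftrightarrow> (\<forall>i\<in>{1..n}. \<delta> (x i \<otimes> inv (y i)) = 0)"
    unfolding dstar_def using nonneg by (intro sum_nonneg_eq_0_iff) auto
  also have "\<dots> \<longleftrightarrow> (\<forall>i\<in>{1..n}. x i = y i)"
    using mem by (simp add: norm_quotient_eq_0_iff)
  \<comment> \<open>Tuples are extensional, so they are determined by the coordinates in \<open>{1..n}\<close>.\<close>
  also have "\<dots> \<longleftrightarrow> x = y"
    using PiE_ext[OF x y] by auto
  finally show "dstar G n \<delta> x y = 0 \<longleftrightarrow> x = y" .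
next
  fix x y z
  assume "x \<in> carrier (group_power G n)" "y \<in> carrier (group_power G n)"
    "z \<in> carrier (group_power G n)"
  then have mem: "x i \<in> carrier G" "y i \<in> carrier G" "z i \<in> carrier G" if "i \<in> {1..n}" for i
    using that by (auto simp only: mem_carrier_group_power)
  show "dstar G n \<delta> x z \<le> dstar G n \<delta> x y + dstar G n \<delta> y z"
    unfolding dstar_def sum.distrib[symmetric] by (intro sum_mono norm_quotient_triangle mem)
qed

lemma dstar_mult_right:
  assumes "a \<in> carrier (group_power G n)" "b \<in> carrier (group_power G n)"
    "c \<in> carrier (group_power G n)"
  shows "dstar G n \<delta> (a \<otimes>\<^bsub>group_power G n\<^esub> c) (b \<otimes>\<^bsub>group_power G n\<^esub> c) = dstar G n \<delta> a b"
  unfolding dstar_def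
proof (rule sum.cong[OF refl])
  fix i assume i: "i \<in> {1..n}"
  then have "a i \<in> carrier G" "b i \<in> carrier G" "c i \<in> carrier G"
    using assms by (auto simp only: mem_carrier_group_power)
  then show "\<delta> ((a \<otimes>\<^bsub>group_power G n\<^esub> c) i \<otimes> inv ((b \<otimes>\<^bsub>group_power G n\<^esub> c) i)) = \<delta> (a i \<otimes> inv (b i))"
    by (simp only: mult_group_power[OF i] quotient_mult_right)
qed

end

theorem lemma2p7:
  fixes G :: "('a, 'b) monoid_scheme" and \<delta> :: "'a \<Rightarrow> real" and n :: nat
  assumes "comm_group G" and "finite (carrier G)"
    and "\<delta> \<in> carrier G \<rightarrow> {0..}"
    and "\<delta> \<one>\<^bsub>G\<^esub> = 0" and "\<forall>d\<in>carrier G. d \<noteq> \<one>\<^bsub>G\<^esub> \<longrightarrow> \<delta> d > 0"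
    and "\<forall>d1\<in>carrier G. \<forall>d2\<in>carrier G. \<delta> (d1 \<otimes>\<^bsub>G\<^esub> d2) \<le> \<delta> d1 + \<delta> d2"
    and "\<forall>d\<in>carrier G. \<delta> (inv\<^bsub>G\<^esub> d) = \<delta> d"
  shows "metric_on (carrier (group_power G n)) (dstar G n \<delta>) \<and>
    (\<forall>a\<in>carrier (group_power G n). \<forall>b\<in>carrier (group_power G n). \<forall>c\<in>carrier (group_power G n).
      dstar G n \<delta> (a \<otimes>\<^bsub>group_power G n\<^esub> c) (b \<otimes>\<^bsub>group_power G n\<^esub> c) = dstar G n \<delta> a b)"
proof -
  interpret comm_group G by fact
  interpret group_norm G \<delta>
  proof unfold_locales
    show "0 \<le> \<delta> x" if "x \<in> carrier G" for x
      using assms(3) that by auto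
    show "\<delta> x = 0 \<longleftrightarrow> x = \<one>\<^bsub>G\<^esub>" if "x \<in> carrier G" for x
      using assms(4,5) that by force
  qed (use assms(6,7) in auto)
  show ?thesis
    using metric_on_dstar dstar_mult_right by blast
qed

end
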